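(* Let $N\ge 2$ be an integer. Assume $u_0\in H^1(\mathbb T^2)$ is real-valued and has mean zero, let $u^0=\Pi_Nu_0$, and assume $\|u^0\|_{L^\infty(\mathbb T^2)}\le 1.25$. Put $E_0=\mathcal E(u^0)$, $F_0=(2\sqrt{2E_0}+3E_0)^2$ and $$\tau_{\max}=\begin{cases}\frac12,& F_0\le 1,\\ \min\Big\{\frac12,\ \frac{1}{(F_0(1+\ln F_0))^2}\Big\},& F_0>1.\end{cases}$$ Then for any $0<\tau\le\tau_{\max}$, the solution of the scheme $$\frac{u^{n+1}-u^n}{\tau}=-\Delta^2u^{n+1}+\Delta\Pi_N(f(u^n)),\quad n\ge 0,$$ satisfies $\mathcal E(u^{n+1})\le\mathcal E(u^n)$ for all $n\ge 0$.
   Context: $\mathbb T^2=\mathbb R^2/\mathbb Z^2=[-\frac12,\frac12)^2$ is the $1$-periodic torus. $f(u)=u^3-u$. The energy (with $\nu=1$) is $$\mathcal E(u)=\int_{\mathbb T^2}\Big(\tfrac12|\nabla u|^2+\tfrac14(u^2-1)^2\Big)dx .$$ $\Pi_N$ is the $L^2$-projection onto $X_N=\operatorname{Span}\{\cos(2\pi k\cdot x),\sin(2\pi k\cdot x):k\in\mathbb Z^2,\ |k|_\infty\le N\}$, where $|k|_\infty=\max_j|k_j|$; i.e. $\Pi_N$ truncates to Fourier modes ($e^{2\pi i k\cdot x}$) with $|k|_\infty\le N$. Each $u^{n+1}\in X_N$ is uniquely determined by $u^n$ through the scheme. *)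

theory Defs
  imports "HOL-Analysis.Analysis" "HOL-Probability.Essential_Supremum"
begin

text \<open>
  A function on the torus is a function on the plane of period 1 in both coordinates; integrals
  over the torus are integrals over the fundamental square.
\<close>

definition periodic :: "(real^2 \<Rightarrow> real) \<Rightarrow> bool" where
  "periodic u \<longleftrightarrow> (\<forall>x. \<forall>m :: int^2. u (x + (\<chi> j. of_int (m $ j))) = u x)"

definition square :: "(real^2) set" where
  "square = {x. \<forall>j. - (1/2) \<le> x $ j \<and> x $ j < 1/2}"

definition torus_int :: "(real^2 \<Rightarrow> real) \<Rightarrow> real" where
  "torus_int g = (LINT x:square|lebesgue. g x)"

definition phase :: "int^2 \<Rightarrow> real^2 \<Rightarrow> real" where
  "phase k x = 2 * pi * (\<Sum>j\<in>UNIV. of_int (k $ j) * x $ j)"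

definition L2_torus :: "(real^2 \<Rightarrow> real) set" where
  "L2_torus = {u. periodic u \<and> u \<in> borel_measurable lebesgue \<and>
                  set_integrable lebesgue square (\<lambda>x. (u x)\<^sup>2)}"

definition fourier_coeff :: "(real^2 \<Rightarrow> real) \<Rightarrow> int^2 \<Rightarrow> complex" where
  "fourier_coeff u k =
     (LINT x:square|lebesgue. complex_of_real (u x) * exp (- (\<i> * of_real (phase k x))))"

definition H1_torus :: "(real^2 \<Rightarrow> real) set" where
  "H1_torus = {u \<in> L2_torus.
     (\<lambda>k. (1 + (\<Sum>j\<in>UNIV. (of_int (k $ j))\<^sup>2)) * (cmod (fourier_coeff u k))\<^sup>2) summable_on UNIV}"

definition Linf_norm :: "(real^2 \<Rightarrow> real) \<Rightarrow> ereal" where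
  "Linf_norm u = esssup (lebesgue_on square) (\<lambda>x. ereal \<bar>u x\<bar>)"

definition modes :: "nat \<Rightarrow> (int^2) set" where
  "modes N = {k. (MAX j. \<bar>k $ j\<bar>) \<le> int N}"

text \<open>
  The real linear span of the functions \<open>cos (phase k)\<close> and \<open>sin (phase k)\<close> for \<open>k \<in> modes N\<close>,
  written out, since functions are not an instance of the class of real vector spaces.
\<close>

definition X_space :: "nat \<Rightarrow> (real^2 \<Rightarrow> real) set" where
  "X_space N = {v. \<exists>a b. v = (\<lambda>x. \<Sum>k\<in>modes N. a k * cos (phase k x) + b k * sin (phase k x))}"

text \<open>
  The orthogonal projection in \<open>L\<^sup>2\<close>, meaningful for \<open>u \<in> L2_torus\<close>; two elements of \<open>X_space N\<close>
  that agree almost everywhere are equal, so the description is unique.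
\<close>

definition proj_X :: "nat \<Rightarrow> (real^2 \<Rightarrow> real) \<Rightarrow> real^2 \<Rightarrow> real" where
  "proj_X N u = (THE v. v \<in> X_space N \<and> (\<forall>w\<in>X_space N. torus_int (\<lambda>x. (u x - v x) * w x) = 0))"

text \<open>
  Derivatives are classical; they are only applied to trigonometric polynomials.
\<close>

definition partial_deriv :: "2 \<Rightarrow> (real^2 \<Rightarrow> real) \<Rightarrow> real^2 \<Rightarrow> real" where
  "partial_deriv j u x = deriv (\<lambda>t. u (x + t *\<^sub>R axis j 1)) 0"

definition grad :: "(real^2 \<Rightarrow> real) \<Rightarrow> real^2 \<Rightarrow> real^2" where
  "grad u x = (\<chi> j. partial_deriv j u x)"

definition laplacian :: "(real^2 \<Rightarrow> real) \<Rightarrow> real^2 \<Rightarrow> real" where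
  "laplacian u x = (\<Sum>j\<in>UNIV. partial_deriv j (partial_deriv j u) x)"

definition nonlin :: "real \<Rightarrow> real" where
  "nonlin v = v ^ 3 - v"

definition energy :: "(real^2 \<Rightarrow> real) \<Rightarrow> real" where
  "energy u = torus_int (\<lambda>x. 1/2 * (norm (grad u x))\<^sup>2 + 1/4 * ((u x)\<^sup>2 - 1)\<^sup>2)"

definition F_const :: "real \<Rightarrow> real" where
  "F_const E = (2 * sqrt (2 * E) + 3 * E)\<^sup>2"

definition tau_max :: "real \<Rightarrow> real" where
  "tau_max F = (if F \<le> 1 then 1/2 else min (1/2) (1 / (F * (1 + ln F))\<^sup>2))"

definition scheme_solution :: "nat \<Rightarrow> real \<Rightarrow> (real^2 \<Rightarrow> real) \<Rightarrow> (nat \<Rightarrow> real^2 \<Rightarrow> real) \<Rightarrow> bool" where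
  "scheme_solution N \<tau> u0 u \<longleftrightarrow>
     u 0 = proj_X N u0 \<and>
     (\<forall>n. u (Suc n) \<in> X_space N \<and>
       (\<forall>x. (u (Suc n) x - u n x) / \<tau> =
            - laplacian (laplacian (u (Suc n))) x
            + laplacian (proj_X N (\<lambda>y. nonlin (u n y))) x))"

end

theory Submission
  imports Defs
begin

text \<open>
  Write \<open>c\<close>, \<open>c'\<close>, \<open>g\<close> for the Fourier coefficients of \<open>u n\<close>, \<open>u (Suc n)\<close> and
  \<open>nonlin (u n)\<close> at one frequency \<open>k\<close>, and \<open>L = |2 \<pi> k|\<^sup>2\<close> for the eigenvalue of minus the Laplacian.
  The scheme says \<open>(c' - c) / \<tau> = - L\<^sup>2 c' - L g\<close> (\<open>scheme_fourier\<close>).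

  \<^emph>\<open>Dissipation.\<close> Testing the scheme with \<open>(- \<Delta>)\<^sup>-\<^sup>1 (u (Suc n) - u n)\<close> shows that the explicit treatment of
  the nonlinearity costs at most \<open>(3 M\<^sup>2 - 1) / 2\<close> times the squared \<open>L\<^sup>2\<close> norm of the increment, if
  \<open>M\<close> bounds both iterates, and gains \<open>1 / (\<tau> L) + L / 2 \<ge> sqrt (2 / \<tau>)\<close> times the squared
  increment in every mode with \<open>L > 0\<close>; the mode with \<open>L = 0\<close> does not change. So the energy decreases (\<open>energy_step\<close>) as soon as both iterates are
  bounded by the critical value \<open>M\<close> with \<open>(3 M\<^sup>2 - 1) / 2 = sqrt (2 / \<tau>)\<close>.

  \<^emph>\<open>Maximum bound.\<close> It remains to keep the iterates below this \<open>M\<close>, which grows like \<open>\<tau>\<close> to the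
  power \<open>- 1/4\<close>. Put \<open>q\<^sup>4 = \<tau>\<close>. Since \<open>c' = (c - \<tau> L g) / (1 + \<tau> L\<^sup>2)\<close>, summing \<open>|c'|\<close> over the modes and
  applying the Cauchy-Schwarz inequality to each half bounds \<open>u (Suc n)\<close> by the gradient of \<open>u n\<close>
  and the \<open>L\<^sup>2\<close> norm of \<open>nonlin (u n) = u n * ((u n)\<^sup>2 - 1)\<close>, hence by the energy and a bound \<open>A\<close> of
  \<open>u n\<close>. Both remaining sums over frequencies are dominated by powers of \<open>q\<close> times the convergent
  lattice sum of \<open>|2 \<pi> k|\<close> to the power \<open>- 3\<close> (\<open>multiplier_bounds\<close>, \<open>lattice_sum\<close>). The hypothesis on \<open>\<tau>\<close>
  yields \<open>\<tau> \<le> 1/2\<close> and \<open>3 E q \<le> 1\<close> for the initial energy \<open>E\<close> (\<open>tau_max_bound\<close>). With the latter, a step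
  from an iterate of energy at most \<open>E\<close> has the bound \<open>2 / (9 q) + A / 3\<close> (\<open>Linf_step\<close>). As \<open>M \<ge> 1 / (3 q)\<close>, the bound \<open>A = M\<close> reproduces itself (\<open>critical_bound\<close>).

  The initial bound \<open>1.25\<close> lies below \<open>M\<close>, so both properties, energy at most the initial one and
  modulus at most \<open>M\<close>, propagate together by induction.
\<close>

section \<open>Fourier coefficients on the torus\<close>

abbreviation torus_measure :: "(real^2) measure" where
  "torus_measure \<equiv> lebesgue_on square"

lemma square_borel [measurable]: "square \<in> sets borel"
proof -
  have "square = (\<Inter>j. {x :: real^2. - (1/2) \<le> x $ j} \<inter> {x. x $ j < 1/2})"
    by (auto simp: square_def)
  also have "\<dots> \<in> sets borel"
    by measurable
  finally show ?thesis .
qed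

lemma square_lebesgue: "square \<inter> space lebesgue \<in> sets (lebesgue :: (real^2) measure)"
  using square_borel by simp

lemma finite_torus_measure: "finite_measure torus_measure"
proof (rule finite_measure_lebesgue_on)
  have "square \<subseteq> cbox (vec (- (1/2))) (vec (1/2))"
    by (auto simp: square_def mem_box_cart less_imp_le)
  then have "bounded square"
    by (rule bounded_subset[rotated]) (rule bounded_cbox)
  then show "square \<in> lmeasurable"
    using square_borel by (intro bounded_set_imp_lmeasurable) auto
qed

lemma torus_int_eq: "torus_int g = integral\<^sup>L torus_measure g"
  unfolding torus_int_def set_lebesgue_integral_def
  by (rule integral_restrict_space[symmetric]) (rule square_lebesgue)

lemma exp_minus_i_phase: "exp (- (\<i> * of_real (phase k x))) = cis (- phase k x)"
  by (simp add: cis_conv_exp)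

lemma fourier_coeff_eq:
  "fourier_coeff u k = (LINT x|torus_measure. complex_of_real (u x) * cis (- phase k x))"
  unfolding fourier_coeff_def set_lebesgue_integral_def exp_minus_i_phase
  by (rule integral_restrict_space[symmetric]) (rule square_lebesgue)

lemma continuous_imp_torus_measurable:
  fixes g :: "real^2 \<Rightarrow> 'b :: euclidean_space"
  assumes "continuous_on UNIV g"
  shows "g \<in> borel_measurable torus_measure"
  using assms by (intro continuous_imp_measurable_on_sets_lebesgue)
     (auto intro: continuous_on_subset simp: square_borel)

lemma phase_inner: "phase k x = 2 * pi * ((\<chi> j. of_int (k $ j)) \<bullet> x)"
  by (simp add: phase_def inner_vec_def)

lemma continuous_phase [continuous_intros]: "continuous_on S (phase k)"
  unfolding phase_inner[abs_def] by (intro continuous_intros)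

lemma continuous_cis_phase [continuous_intros]: "continuous_on S (\<lambda>x. cis (phase k x))"
  unfolding cis_conv_exp by (intro continuous_intros)

lemma phase_minus_left: "phase (- k) x = - phase k x"
  by (simp add: phase_def sum_negf)

lemma phase_diff_left: "phase (k - l) x = phase k x - phase l x"
  by (simp add: phase_def sum_subtractf algebra_simps)

lemma phase_zero: "phase 0 x = 0"
  by (simp add: phase_def)

text \<open>
  For \<open>n \<noteq> 0\<close> the integrand has an antiderivative of period \<open>1\<close>. The half-open interval matches the
  definition of \<open>square\<close> and differs from the closed one by a null set.
\<close>

lemma integral_cis_interval:
  "(LINT t|lborel. indicator {- (1/2)..<1/2} t *\<^sub>R cis (2 * pi * of_int n * t)) =
     (if n = 0 then 1 else 0)" (is "?L = _")
proof -
  let ?f = "\<lambda>t::real. cis (2 * pi * of_int n * t)"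
  have [measurable]: "?f \<in> borel_measurable borel"
    unfolding cis_conv_exp by (intro borel_measurable_continuous_onI continuous_intros)
  have L: "?L = (LINT t|lborel. indicator {- (1/2)..1/2} t *\<^sub>R ?f t)"
  proof (rule integral_cong_AE)
    show "AE t in lborel. indicator {- (1/2)..<1/2} t *\<^sub>R ?f t = indicator {- (1/2)..1/2} t *\<^sub>R ?f t"
      using AE_lborel_singleton[of "1/2::real"] by eventually_elim (auto simp: indicator_def)
  qed measurable
  show ?thesis
  proof (cases "n = 0")
    case True
    have "?L = complex_of_real 1"
      unfolding L using True
      by (subst integral_FTC_atLeastAtMost[where F = "\<lambda>t. of_real t"])
         (auto intro!: derivative_eq_intros continuous_intros simp: has_vector_derivative_def scaleR_conv_of_real)
    then show ?thesis using True by simp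
  next
    case False
    let ?c = "2 * pi * of_int n :: real"
    have c: "?c \<noteq> 0" using False by simp
    let ?F = "\<lambda>t. cis (?c * t) / (\<i> * of_real ?c)"
    have "?L = ?F (1/2) - ?F (- (1/2))"
      unfolding L
    proof (rule integral_FTC_atLeastAtMost)
      show "continuous_on {- (1/2)..1/2} ?f"
        unfolding cis_conv_exp by (intro continuous_intros)
      fix t :: real
      have "((\<lambda>t. exp (\<i> * of_real ?c * of_real t) / (\<i> * of_real ?c)) has_vector_derivative
         exp (\<i> * of_real ?c * of_real t)) (at t within {- (1/2)..1/2})"
        using c by (auto intro!: derivative_eq_intros has_vector_derivative_real_field
           simp: field_simps)
      then show "(?F has_vector_derivative ?f t) (at t within {- (1/2)..1/2})"
        by (simp add: cis_conv_exp mult_ac)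
    qed auto
    also have "\<dots> = 0"
    proof -
      have "cis (?c * (1/2)) = cis (?c * (- (1/2)) + 2 * pi * of_int n)"
        by (simp add: algebra_simps)
      also have "\<dots> = cis (?c * (- (1/2)))"
        by (simp only: cis_mult[symmetric] cis_multiple_2pi[OF Ints_of_int] mult_1_right)
      finally show ?thesis by (simp only: diff_self)
    qed
    finally show ?thesis using False by simp
  qed
qed

text \<open>
  The exponentials are orthogonal by Fubini's theorem, one coordinate at a time: Lebesgue measure on the plane is a product measure, and both
  the square and \<open>cis (phase k x)\<close> factor over the coordinates.
\<close>

lemma integral_cis_phase:
  "(LINT x|torus_measure. cis (phase k x)) = (if k = 0 then 1 else 0)"
proof -
  define \<kappa> :: "real^2" where "\<kappa> = (\<chi> j. of_int (k $ j))"
  let ?I = "{- (1/2)..<1/2::real}"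
  define g where "g b t = indicat_real ?I t *\<^sub>R cis (2 * pi * (\<kappa> \<bullet> b) * t)"
    for b :: "real^2" and t
  have int_coord: "\<exists>n. \<kappa> \<bullet> b = of_int n" if "b \<in> Basis" for b
    using that by (auto simp: Basis_vec_def inner_axis \<kappa>_def)
  have factor: "indicat_real square x *\<^sub>R cis (phase k x) = (\<Prod>b\<in>Basis. g b (x \<bullet> b))" for x
  proof -
    have "phase k x = (\<Sum>b\<in>Basis. 2 * pi * (\<kappa> \<bullet> b) * (x \<bullet> b))"
      unfolding phase_inner \<kappa>_def[symmetric]
      by (subst euclidean_inner) (simp add: sum_distrib_left mult_ac)
    then have c: "cis (phase k x) = (\<Prod>b\<in>Basis. cis (2 * pi * (\<kappa> \<bullet> b) * (x \<bullet> b)))"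
      by (simp add: cis_conv_exp sum_distrib_left exp_sum)
    have "x \<in> square \<longleftrightarrow> (\<forall>b\<in>Basis. x \<bullet> b \<in> ?I)"
      by (auto simp: square_def Basis_vec_def inner_axis)
    then have "indicat_real square x = (\<Prod>b\<in>Basis. indicat_real ?I (x \<bullet> b))"
      by (auto simp: indicator_def)
    then show ?thesis
      unfolding g_def c by (simp add: prod.distrib scaleR_conv_of_real)
  qed
  have meas [measurable]: "g b \<in> borel_measurable borel" for b
    unfolding g_def[abs_def] cis_conv_exp
    by (intro borel_measurable_scaleR borel_measurable_indicator
        borel_measurable_continuous_onI[of "\<lambda>t. exp _"] continuous_intros) auto
  have g_int: "integrable lborel (g b)" for b
  proof -
    have "integrable lborel (\<lambda>t. indicat_real ?I t *\<^sub>R cis (2 * pi * (\<kappa> \<bullet> b) * t))"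
      using meas[of b] by (intro integrableI_bounded_set_indicator[where B = 1])
        (auto simp: cis_conv_exp intro!: borel_measurable_continuous_onI continuous_on_exp continuous_on_mult continuous_on_of_real continuous_on_const continuous_on_id)
    then show ?thesis by (simp add: g_def[abs_def])
  qed
  interpret product_sigma_finite "\<lambda>b :: real^2. lborel :: real measure" ..
  have "(LINT x|torus_measure. cis (phase k x)) =
        (LINT x|lebesgue. indicat_real square x *\<^sub>R cis (phase k x))"
    by (rule integral_restrict_space) (rule square_lebesgue)
  also have "\<dots> = (LINT x|lborel. indicat_real square x *\<^sub>R cis (phase k x))"
    by (intro integral_completion borel_measurable_scaleR borel_measurable_indicator)
       (auto intro!: borel_measurable_continuous_onI continuous_intros)
  also have "\<dots> = (LINT x|lborel. (\<Prod>b\<in>Basis. g b (x \<bullet> b)))"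
    by (simp only: factor)
  also have "\<dots> = (LINT f|Pi\<^sub>M Basis (\<lambda>b. lborel). (\<Prod>b\<in>Basis. g b (f b)))"
    by (subst lborel_eq, subst integral_distr) (auto intro!: Bochner_Integration.integral_cong prod.cong)
  also have "\<dots> = (\<Prod>b\<in>Basis. integral\<^sup>L lborel (g b))"
    using g_int by (intro product_integral_prod) auto
  also have "\<dots> = (\<Prod>b\<in>Basis. if \<kappa> \<bullet> b = 0 then 1 else 0)"
  proof (rule prod.cong)
    fix b :: "real^2" assume "b \<in> Basis"
    then obtain n where n: "\<kappa> \<bullet> b = of_int n" using int_coord by blast
    show "integral\<^sup>L lborel (g b) = (if \<kappa> \<bullet> b = 0 then 1 else 0)"
      using integral_cis_interval[of n] by (simp add: g_def[abs_def] n)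
  qed simp
  also have "\<dots> = (if \<kappa> = 0 then 1 else 0)"
    using euclidean_all_zero_iff[of \<kappa>] by auto
  also have "\<kappa> = 0 \<longleftrightarrow> k = 0"
    by (auto simp: \<kappa>_def vec_eq_iff)
  finally show ?thesis by simp
qed

lemma continuous_imp_torus_integrable:
  fixes g :: "real^2 \<Rightarrow> 'b :: euclidean_space"
  assumes "continuous_on UNIV g"
  shows "integrable torus_measure g"
proof -
  let ?C = "cbox (vec (- (1/2))) (vec (1/2)) :: (real^2) set"
  have "compact (g ` ?C)"
    using assms by (intro compact_continuous_image) (auto intro: continuous_on_subset)
  then obtain B where B: "\<And>x. x \<in> ?C \<Longrightarrow> norm (g x) \<le> B"
    by (meson bounded_iff compact_imp_bounded imageI)
  have "square \<subseteq> ?C"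
    by (auto simp: square_def mem_box_cart less_imp_le)
  then have "AE x in torus_measure. norm (g x) \<le> B"
    by (intro AE_I2) (use B in auto)
  then show ?thesis
    using assms finite_torus_measure
    by (intro finite_measure.integrable_const_bound continuous_imp_torus_measurable)
qed

lemma integrable_mult_cis_phase:
  assumes "integrable torus_measure g"
  shows "integrable torus_measure (\<lambda>x. complex_of_real (g x) * cis (phase k x))"
proof (rule Bochner_Integration.integrable_bound[OF assms])
  have "g \<in> borel_measurable torus_measure" using assms by simp
  moreover have "(\<lambda>x. cis (phase k x)) \<in> borel_measurable torus_measure"
    by (intro continuous_imp_torus_measurable continuous_intros)
  ultimately show "(\<lambda>x. complex_of_real (g x) * cis (phase k x)) \<in> borel_measurable torus_measure"
    by measurable
qed (auto simp: norm_mult)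

lemma cnj_fourier_coeff:
  "cnj (fourier_coeff u k) = (LINT x|torus_measure. complex_of_real (u x) * cis (phase k x))"
  unfolding fourier_coeff_eq
  by (subst Bochner_Integration.integral_cnj[symmetric]) (simp add: cis_cnj)

lemma fourier_coeff_minus: "fourier_coeff u (- k) = cnj (fourier_coeff u k)"
  unfolding cnj_fourier_coeff by (simp add: fourier_coeff_eq phase_minus_left)

lemma fourier_coeff_zero: "fourier_coeff u 0 = of_real (torus_int u)"
  by (simp add: fourier_coeff_eq torus_int_eq phase_zero)

lemma fourier_coeff_diff:
  assumes "integrable torus_measure f" "integrable torus_measure g"
  shows "fourier_coeff (\<lambda>x. f x - g x) k = fourier_coeff f k - fourier_coeff g k"
  using integrable_mult_cis_phase[OF assms(1), of "- k"] integrable_mult_cis_phase[OF assms(2), of "- k"]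
  by (simp add: fourier_coeff_eq phase_minus_left left_diff_distrib)

text \<open>
  The square has finite measure and \<open>\<bar>t\<bar> \<le> 1 + t\<^sup>2\<close>.
\<close>

lemma L2_torus_integrable:
  assumes "u \<in> L2_torus"
  shows "integrable torus_measure u"
proof -
  have m: "u \<in> borel_measurable torus_measure"
    using assms by (auto simp: L2_torus_def intro: measurable_restrict_space1)
  have "integrable torus_measure (\<lambda>x. (u x)\<^sup>2)"
    using assms square_lebesgue unfolding L2_torus_def set_integrable_def
    by (simp add: integrable_restrict_space)
  moreover have "integrable torus_measure (\<lambda>x. 1 :: real)"
    by (intro continuous_imp_torus_integrable continuous_intros)
  ultimately have "integrable torus_measure (\<lambda>x. 1 + (u x)\<^sup>2)"
    by (rule Bochner_Integration.integrable_add[rotated])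
  then show ?thesis
  proof (rule Bochner_Integration.integrable_bound[OF _ m], intro AE_I2)
    fix x
    have "0 \<le> (\<bar>u x\<bar> - 1/2)\<^sup>2" by simp
    then show "norm (u x) \<le> norm (1 + (u x)\<^sup>2)"
      by (simp add: power2_diff power_divide)
  qed
qed

section \<open>Trigonometric polynomials\<close>

lemma modes_iff: "k \<in> modes N \<longleftrightarrow> (\<forall>j. \<bar>k $ j\<bar> \<le> int N)"
  unfolding modes_def by (auto simp: Max_le_iff)

lemma card_modes: "card (modes N) = (2 * N + 1)\<^sup>2"
proof -
  let ?I = "{- int N..int N}"
  have "bij_betw (\<lambda>k :: int^2. (k $ 1, k $ 2)) (modes N) (?I \<times> ?I)"
    by (rule bij_betwI[where g = "\<lambda>(a, b). vector [a, b]"])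
       (auto simp: modes_iff forall_2 vec_eq_iff abs_le_iff)
  then have "card (modes N) = card (?I \<times> ?I)"
    by (rule bij_betw_same_card)
  also have "\<dots> = (2 * N + 1)\<^sup>2"
  proof -
    have "nat (int N - - int N + 1) = 2 * N + 1" by linarith
    then show ?thesis by (simp only: card_cartesian_product card_atLeastAtMost_int power2_eq_square)
  qed
  finally show ?thesis .
qed

lemma finite_modes [simp]: "finite (modes N)"
  by (rule card_ge_0_finite) (simp add: card_modes)

lemma modes_minus_iff [simp]: "- k \<in> modes N \<longleftrightarrow> k \<in> modes N"
  by (simp add: modes_iff)

lemma sum_modes_minus: "(\<Sum>k\<in>modes N. f (- k)) = (\<Sum>k\<in>modes N. f k)"
  by (rule sum.reindex_bij_witness[of _ uminus uminus]) auto

text \<open>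
  Real parts of complex terms keep differentiation and multiplication by constants on the level of
  the coefficients.
\<close>

definition trig :: "nat \<Rightarrow> (int^2 \<Rightarrow> complex) \<Rightarrow> real^2 \<Rightarrow> real" where
  "trig N c x = (\<Sum>k\<in>modes N. Re (c k * cis (phase k x)))"

definition hermitian :: "(int^2 \<Rightarrow> complex) \<Rightarrow> bool" where
  "hermitian c \<longleftrightarrow> (\<forall>k. c (- k) = cnj (c k))"

lemma hermitian_fourier_coeff: "hermitian (fourier_coeff u)"
  by (simp add: hermitian_def fourier_coeff_minus)

lemma trig_cong: "(\<And>k. k \<in> modes N \<Longrightarrow> c k = d k) \<Longrightarrow> trig N c = trig N d"
  by (simp add: trig_def fun_eq_iff)

lemma trig_diff: "trig N c x - trig N d x = trig N (\<lambda>k. c k - d k) x"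
  by (simp only: trig_def sum_subtractf left_diff_distrib minus_complex.sel)

lemma trig_add: "trig N c x + trig N d x = trig N (\<lambda>k. c k + d k) x"
  by (simp only: trig_def sum.distrib distrib_right plus_complex.sel)

lemma trig_scale: "a * trig N c x = trig N (\<lambda>k. of_real a * c k) x"
  by (simp add: trig_def sum_distrib_left algebra_simps)

lemma continuous_trig [continuous_intros]: "continuous_on S (trig N c)"
  unfolding trig_def[abs_def] by (intro continuous_intros)

lemma abs_trig_le: "\<bar>trig N c x\<bar> \<le> (\<Sum>k\<in>modes N. cmod (c k))"
  unfolding trig_def
  by (rule order_trans[OF sum_abs sum_mono])
     (metis abs_Re_le_cmod mult.right_neutral norm_cis norm_mult)

lemma trig_in_X_space: "trig N c \<in> X_space N"
  unfolding X_space_def mem_Collect_eq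
  by (rule exI[of _ "\<lambda>k. Re (c k)"], rule exI[of _ "\<lambda>k. - Im (c k)"])
     (simp add: trig_def fun_eq_iff)

text \<open>
  The terms of a trigonometric polynomial at \<open>k\<close> and \<open>- k\<close> span the same functions, so the
  coefficients are not unique; averaging over this pair makes them hermitian, and then they are
  the Fourier coefficients.
\<close>

lemma trig_symmetrize:
  "trig N c = trig N (\<lambda>k. (c k + cnj (c (- k))) / 2)"
proof
  fix x
  have "trig N c x = (\<Sum>k\<in>modes N. Re (c (- k) * cis (phase (- k) x)))"
    unfolding trig_def by (rule sum_modes_minus[symmetric])
  also have "\<dots> = trig N (\<lambda>k. cnj (c (- k))) x"
    unfolding trig_def phase_minus_left by (intro sum.cong) simp_all
  finally have "2 * trig N c x = trig N c x + trig N (\<lambda>k. cnj (c (- k))) x"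
    by simp
  also have "\<dots> = 2 * trig N (\<lambda>k. (c k + cnj (c (- k))) / 2) x"
    unfolding trig_add trig_scale by (rule trig_cong[THEN fun_cong]) simp
  finally show "trig N c x = trig N (\<lambda>k. (c k + cnj (c (- k))) / 2) x" by simp
qed

lemma fourier_coeff_trig:
  assumes "hermitian c" "k \<in> modes N"
  shows "fourier_coeff (trig N c) k = c k"
proof -
  have split: "complex_of_real (Re (c l * cis (phase l x))) * cis (- phase k x) =
       (c l * cis (phase (l - k) x) + c (- l) * cis (phase (- l - k) x)) / 2" for l x
  proof -
    have "complex_of_real (Re (c l * cis (phase l x))) = (c l * cis (phase l x) + c (- l) * cis (- phase l x)) / 2"
      using assms(1) by (simp add: complex_eq_iff hermitian_def)
    then have "complex_of_real (Re (c l * cis (phase l x))) * cis (- phase k x) =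
        (c l * (cis (phase l x) * cis (- phase k x)) + c (- l) * (cis (- phase l x) * cis (- phase k x))) / 2"
      by (simp only: distrib_right times_divide_eq_left mult.assoc)
    then show ?thesis
      by (simp only: cis_mult phase_diff_left phase_minus_left add_uminus_conv_diff)
  qed
  have I: "integrable torus_measure (\<lambda>x. a * cis (phase l x))" for a :: complex and l
    by (intro continuous_imp_torus_integrable continuous_intros)
  have "fourier_coeff (trig N c) k =
      (LINT x|torus_measure. (\<Sum>l\<in>modes N. (c l * cis (phase (l - k) x) + c (- l) * cis (phase (- l - k) x)) / 2))"
    unfolding fourier_coeff_eq trig_def of_real_sum sum_distrib_right split ..
  also have "\<dots> = (\<Sum>l\<in>modes N. (c l * (if l = k then 1 else 0) + c (- l) * (if - l = k then 1 else 0)) / 2)"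
    by (simp add: I integral_cis_phase)
  also have "\<dots> = ((\<Sum>l\<in>modes N. c l * (if l = k then 1 else 0)) +
      (\<Sum>l\<in>modes N. c (- l) * (if - l = k then 1 else 0))) / 2"
    by (simp only: sum.distrib flip: sum_divide_distrib)
  also have "(\<Sum>l\<in>modes N. c (- l) * (if - l = k then 1 else 0)) = (\<Sum>l\<in>modes N. c l * (if l = k then 1 else 0))"
    by (rule sum_modes_minus)
  also have "(\<Sum>l\<in>modes N. c l * (if l = k then 1 else 0)) = c k"
    using assms(2) by (simp add: if_distrib cong: if_cong)
  finally show ?thesis by simp
qed

lemma X_space_eq_trig:
  assumes "u \<in> X_space N"
  shows "u = trig N (fourier_coeff u)"
proof -
  obtain a b where u: "u = (\<lambda>x. \<Sum>k\<in>modes N. a k * cos (phase k x) + b k * sin (phase k x))"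
    using assms by (auto simp: X_space_def)
  define c where "c k = Complex (a k) (- b k)" for k
  define d where "d k = (c k + cnj (c (- k))) / 2" for k
  have "u = trig N c"
    by (simp add: u trig_def c_def fun_eq_iff)
  also have "\<dots> = trig N d"
    unfolding d_def by (rule trig_symmetrize)
  finally have ud: "u = trig N d" .
  have "hermitian d"
    by (simp add: hermitian_def d_def add.commute)
  then show ?thesis
    using ud fourier_coeff_trig[of d _ N] by (metis trig_cong)
qed

lemma continuous_X_space: "u \<in> X_space N \<Longrightarrow> continuous_on S u"
  by (subst X_space_eq_trig, assumption) (rule continuous_trig)

text \<open>
  This converts every pairing with a trigonometric polynomial into Fourier coefficients; Parseval's
  identity, Bessel's inequality and the description of \<open>proj_X\<close> all rest on it.
\<close>

lemma torus_int_mult_trig: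
  assumes "integrable torus_measure g"
  shows "torus_int (\<lambda>x. g x * trig N d x) =
         (\<Sum>k\<in>modes N. Re (d k * cnj (fourier_coeff g k)))"
proof -
  have I: "integrable torus_measure (\<lambda>x. d k * (complex_of_real (g x) * cis (phase k x)))" for k
    using integrable_mult_cis_phase[OF assms] by simp
  have "torus_int (\<lambda>x. g x * trig N d x) =
      (LINT x|torus_measure. (\<Sum>k\<in>modes N. Re (d k * (complex_of_real (g x) * cis (phase k x)))))"
    unfolding torus_int_eq trig_def sum_distrib_left
    by (intro Bochner_Integration.integral_cong sum.cong) (simp_all add: algebra_simps)
  also have "\<dots> = (\<Sum>k\<in>modes N. (LINT x|torus_measure. Re (d k * (complex_of_real (g x) * cis (phase k x)))))"
    using I by (intro Bochner_Integration.integral_sum integrable_Re)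
  also have "\<dots> = (\<Sum>k\<in>modes N. Re (d k * cnj (fourier_coeff g k)))"
    unfolding cnj_fourier_coeff Bochner_Integration.integral_mult_right_zero[symmetric]
    using I by (intro sum.cong integral_Re) simp_all
  finally show ?thesis .
qed

lemma torus_int_power2_X_space:
  assumes "u \<in> X_space N"
  shows "torus_int (\<lambda>x. (u x)\<^sup>2) = (\<Sum>k\<in>modes N. (cmod (fourier_coeff u k))\<^sup>2)"
proof -
  have "torus_int (\<lambda>x. (u x)\<^sup>2) = torus_int (\<lambda>x. u x * trig N (fourier_coeff u) x)"
    using X_space_eq_trig[OF assms] by (simp add: power2_eq_square)
  also have "\<dots> = (\<Sum>k\<in>modes N. Re (fourier_coeff u k * cnj (fourier_coeff u k)))"
    using assms by (intro torus_int_mult_trig continuous_imp_torus_integrable continuous_X_space)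
  finally show ?thesis
    by (simp add: complex_mult_cnj cmod_power2)
qed

text \<open>
  Bessel's inequality, from the nonnegativity of the square integral of \<open>g\<close> minus its truncated Fourier series.
\<close>

lemma bessel:
  assumes "continuous_on UNIV g"
  shows "(\<Sum>k\<in>modes N. (cmod (fourier_coeff g k))\<^sup>2) \<le> torus_int (\<lambda>x. (g x)\<^sup>2)"
proof -
  let ?p = "trig N (fourier_coeff g)"
  let ?S = "\<Sum>k\<in>modes N. (cmod (fourier_coeff g k))\<^sup>2"
  note int = continuous_imp_torus_integrable
  have gp: "torus_int (\<lambda>x. g x * ?p x) = ?S"
    by (simp add: torus_int_mult_trig int assms complex_mult_cnj cmod_power2)
  have pp: "torus_int (\<lambda>x. (?p x)\<^sup>2) = ?S"
    unfolding torus_int_power2_X_space[OF trig_in_X_space]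
    by (intro sum.cong) (simp_all add: fourier_coeff_trig hermitian_fourier_coeff)
  have "0 \<le> torus_int (\<lambda>x. (g x - ?p x)\<^sup>2)"
    unfolding torus_int_eq by (intro Bochner_Integration.integral_nonneg) simp
  also have "\<dots> = torus_int (\<lambda>x. (g x)\<^sup>2) - 2 * torus_int (\<lambda>x. g x * ?p x) + torus_int (\<lambda>x. (?p x)\<^sup>2)"
    unfolding torus_int_eq power2_diff
    using int[of "\<lambda>x. (g x)\<^sup>2"] int[of "\<lambda>x. (?p x)\<^sup>2"] int[of "\<lambda>x. g x * ?p x"] assms
    by (simp add: continuous_intros mult.assoc)
  finally show ?thesis unfolding gp pp by simp
qed

text \<open>
  By \<open>torus_int_mult_trig\<close>, the residual \<open>g - v\<close> is orthogonal to all of \<open>X_space N\<close> exactly when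
  its coefficients on \<open>modes N\<close> vanish; the test function with these very coefficients detects them.
  So the defining condition has the truncated Fourier series as its only solution.
\<close>

lemma proj_X_eq:
  assumes "integrable torus_measure g"
  shows "proj_X N g = trig N (fourier_coeff g)"
proof -
  have key: "(\<forall>w\<in>X_space N. torus_int (\<lambda>x. (g x - v x) * w x) = 0) \<longleftrightarrow>
      (\<forall>k\<in>modes N. fourier_coeff v k = fourier_coeff g k)" if v: "v \<in> X_space N" for v
  proof -
    have iv: "integrable torus_measure v"
      using v by (intro continuous_imp_torus_integrable continuous_X_space)
    then have tr: "torus_int (\<lambda>x. (g x - v x) * trig N d x) =
        (\<Sum>k\<in>modes N. Re (d k * cnj (fourier_coeff g k - fourier_coeff v k)))" for d
      using assms by (simp add: torus_int_mult_trig fourier_coeff_diff)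
    show ?thesis
    proof
      assume "\<forall>w\<in>X_space N. torus_int (\<lambda>x. (g x - v x) * w x) = 0"
      then have "0 = (\<Sum>k\<in>modes N. (cmod (fourier_coeff g k - fourier_coeff v k))\<^sup>2)"
        using tr[of "\<lambda>k. fourier_coeff g k - fourier_coeff v k"] trig_in_X_space
        by (simp only: complex_mult_cnj cmod_power2 Re_complex_of_real)
      note zero = sum_nonneg_0[OF finite_modes zero_le_power2 this[symmetric]]
      show "\<forall>k\<in>modes N. fourier_coeff v k = fourier_coeff g k"
      proof
        fix k assume "k \<in> modes N"
        from zero[OF this] show "fourier_coeff v k = fourier_coeff g k" by simp
      qed
    next
      assume eq: "\<forall>k\<in>modes N. fourier_coeff v k = fourier_coeff g k"
      show "\<forall>w\<in>X_space N. torus_int (\<lambda>x. (g x - v x) * w x) = 0"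
      proof
        fix w assume "w \<in> X_space N"
        then have w: "trig N (fourier_coeff w) = w"
          by (rule X_space_eq_trig[symmetric])
        have "torus_int (\<lambda>x. (g x - v x) * trig N (fourier_coeff w) x) = 0"
          unfolding tr using eq by (intro sum.neutral) simp
        then show "torus_int (\<lambda>x. (g x - v x) * w x) = 0"
          unfolding w .
      qed
    qed
  qed
  have p: "fourier_coeff (trig N (fourier_coeff g)) k = fourier_coeff g k" if "k \<in> modes N" for k
    using that by (rule fourier_coeff_trig[OF hermitian_fourier_coeff])
  show ?thesis
    unfolding proj_X_def
  proof (rule the_equality)
    show "trig N (fourier_coeff g) \<in> X_space N \<and>
      (\<forall>w\<in>X_space N. torus_int (\<lambda>x. (g x - trig N (fourier_coeff g) x) * w x) = 0)"
      using key[OF trig_in_X_space] p trig_in_X_space by blast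
    fix v
    assume "v \<in> X_space N \<and> (\<forall>w\<in>X_space N. torus_int (\<lambda>x. (g x - v x) * w x) = 0)"
    then have "v \<in> X_space N" "\<forall>k\<in>modes N. fourier_coeff v k = fourier_coeff g k"
      using key by blast+
    then show "v = trig N (fourier_coeff g)"
      using X_space_eq_trig trig_cong by metis
  qed
qed

section \<open>Derivatives, energy and scheme in Fourier coefficients\<close>

lemma phase_shift: "phase k (x + t *\<^sub>R axis j 1) = phase k x + t * (2 * pi * of_int (k $ j))"
  unfolding phase_inner by (simp add: inner_add_right inner_axis algebra_simps)

lemma partial_deriv_trig:
  "partial_deriv j (trig N c) = trig N (\<lambda>k. \<i> * of_real (2 * pi * of_int (k $ j)) * c k)"
proof
  fix x
  have "((\<lambda>t. trig N c (x + t *\<^sub>R axis j 1)) has_real_derivative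
      trig N (\<lambda>k. \<i> * of_real (2 * pi * of_int (k $ j)) * c k) x) (at 0)"
    unfolding trig_def phase_shift
    by (auto intro!: derivative_eq_intros sum.cong simp: algebra_simps)
  then show "partial_deriv j (trig N c) x = trig N (\<lambda>k. \<i> * of_real (2 * pi * of_int (k $ j)) * c k) x"
    unfolding partial_deriv_def by (rule DERIV_imp_deriv)
qed

text \<open>
  The eigenvalue \<open>|2 \<pi> k|\<^sup>2\<close> of minus the Laplacian on the mode \<open>k\<close>.
\<close>

definition lap_eig :: "int^2 \<Rightarrow> real" where
  "lap_eig k = (\<Sum>j\<in>UNIV. (2 * pi * of_int (k $ j))\<^sup>2)"

lemma lap_eig_minus [simp]: "lap_eig (- k) = lap_eig k"
  by (simp add: lap_eig_def)

lemma lap_eig_nonneg [simp]: "0 \<le> lap_eig k"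
  by (simp add: lap_eig_def sum_nonneg)

lemma lap_eig_zero_iff: "lap_eig k = 0 \<longleftrightarrow> k = 0"
  by (auto simp: lap_eig_def sum_nonneg_eq_0_iff vec_eq_iff)

lemma laplacian_trig: "laplacian (trig N c) = trig N (\<lambda>k. - of_real (lap_eig k) * c k)"
proof
  fix x
  have "laplacian (trig N c) x =
      (\<Sum>j\<in>UNIV. trig N (\<lambda>k. - of_real ((2 * pi * of_int (k $ j))\<^sup>2) * c k) x)"
    unfolding laplacian_def partial_deriv_trig
    by (intro sum.cong refl trig_cong[THEN fun_cong]) (simp add: power2_eq_square)
  also have "\<dots> = trig N (\<lambda>k. - of_real (lap_eig k) * c k) x"
    unfolding trig_def lap_eig_def
    by (subst sum.swap)
       (simp only: of_real_sum sum_distrib_right Re_sum flip: sum_negf)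
  finally show "laplacian (trig N c) x = trig N (\<lambda>k. - of_real (lap_eig k) * c k) x" .
qed

lemma energy_X_space:
  assumes u: "u \<in> X_space N"
  shows "energy u = 1/2 * (\<Sum>k\<in>modes N. lap_eig k * (cmod (fourier_coeff u k))\<^sup>2)
           + 1/4 * torus_int (\<lambda>x. ((u x)\<^sup>2 - 1)\<^sup>2)"
proof -
  let ?c = "fourier_coeff u"
  let ?d = "\<lambda>j k. \<i> * of_real (2 * pi * of_int (k $ j)) * ?c k"
  have pd: "partial_deriv j u = trig N (?d j)" for j
    by (subst X_space_eq_trig[OF u]) (rule partial_deriv_trig)
  have herm: "hermitian (?d j)" for j
    using hermitian_fourier_coeff[of u] by (simp add: hermitian_def)
  have sq: "torus_int (\<lambda>x. (trig N (?d j) x)\<^sup>2) =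
      (\<Sum>k\<in>modes N. (2 * pi * of_int (k $ j))\<^sup>2 * (cmod (?c k))\<^sup>2)" for j
    unfolding torus_int_power2_X_space[OF trig_in_X_space]
    by (intro sum.cong refl, subst fourier_coeff_trig[OF herm])
       (simp_all add: norm_mult power_mult_distrib)
  have "energy u = torus_int (\<lambda>x. 1/2 * (\<Sum>j\<in>UNIV. (trig N (?d j) x)\<^sup>2) + 1/4 * ((u x)\<^sup>2 - 1)\<^sup>2)"
    unfolding energy_def norm_vec_def L2_set_def grad_def pd by (simp add: sum_nonneg)
  also have "\<dots> = 1/2 * (\<Sum>j\<in>UNIV. torus_int (\<lambda>x. (trig N (?d j) x)\<^sup>2))
      + 1/4 * torus_int (\<lambda>x. ((u x)\<^sup>2 - 1)\<^sup>2)"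
    unfolding torus_int_eq
    by (subst Bochner_Integration.integral_add)
       (auto intro!: Bochner_Integration.integral_sum continuous_imp_torus_integrable continuous_intros continuous_X_space[OF u])
  also have "(\<Sum>j\<in>UNIV. torus_int (\<lambda>x. (trig N (?d j) x)\<^sup>2)) =
      (\<Sum>k\<in>modes N. lap_eig k * (cmod (?c k))\<^sup>2)"
    unfolding sq lap_eig_def by (subst sum.swap) (simp only: sum_distrib_right)
  finally show ?thesis .
qed

lemma energy_nonneg: "u \<in> X_space N \<Longrightarrow> 0 \<le> energy u"
  unfolding energy_X_space torus_int_eq
  by (intro add_nonneg_nonneg mult_nonneg_nonneg sum_nonneg Bochner_Integration.integral_nonneg) auto

lemma continuous_nonlin: "u \<in> X_space N \<Longrightarrow> continuous_on S (\<lambda>x. nonlin (u x))"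
  unfolding nonlin_def by (intro continuous_intros continuous_X_space)

lemma scheme_in_X_space:
  assumes "scheme_solution N \<tau> u0 u" "u0 \<in> L2_torus"
  shows "u n \<in> X_space N"
proof (cases n)
  case 0
  then show ?thesis
    using assms by (simp add: scheme_solution_def proj_X_eq L2_torus_integrable trig_in_X_space)
next
  case (Suc m)
  then show ?thesis using assms(1) by (simp add: scheme_solution_def)
qed

text \<open>
  Both sides of the scheme are trigonometric polynomials with hermitian coefficients, so the
  pointwise equation may be compared coefficient by coefficient.
\<close>

lemma scheme_fourier:
  assumes sol: "scheme_solution N \<tau> u0 u" "u0 \<in> L2_torus" and k: "k \<in> modes N"
  shows "(fourier_coeff (u (Suc n)) k - fourier_coeff (u n) k) / of_real \<tau> =
         - (of_real (lap_eig k))\<^sup>2 * fourier_coeff (u (Suc n)) k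
         - of_real (lap_eig k) * fourier_coeff (\<lambda>x. nonlin (u n x)) k"
proof -
  let ?c = "fourier_coeff (u n)" and ?c' = "fourier_coeff (u (Suc n))"
    and ?g = "fourier_coeff (\<lambda>x. nonlin (u n x))"
  let ?L = "\<lambda>k. complex_of_real (lap_eig k)"
  note X = scheme_in_X_space[OF sol]
  have rep: "u m = trig N (fourier_coeff (u m))" for m
    using X by (rule X_space_eq_trig)
  have proj: "proj_X N (\<lambda>x. nonlin (u n x)) = trig N ?g"
    using X by (intro proj_X_eq continuous_imp_torus_integrable continuous_nonlin)
  let ?l = "\<lambda>k. of_real (1 / \<tau>) * (?c' k - ?c k)"
  let ?r = "\<lambda>k. of_real (-1) * (- ?L k * (- ?L k * ?c' k)) + - ?L k * ?g k"
  have "trig N ?l = trig N ?r"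
  proof
    fix x
    have "trig N ?l x = (u (Suc n) x - u n x) / \<tau>"
      by (simp only: trig_scale[symmetric] trig_diff[symmetric] rep[symmetric]) simp
    also have "\<dots> = - laplacian (laplacian (u (Suc n))) x + laplacian (proj_X N (\<lambda>y. nonlin (u n y))) x"
      using sol(1) unfolding scheme_solution_def by blast
    also have "laplacian (laplacian (u (Suc n))) = trig N (\<lambda>k. - ?L k * (- ?L k * ?c' k))"
      by (subst rep) (simp only: laplacian_trig)
    also have "laplacian (proj_X N (\<lambda>y. nonlin (u n y))) = trig N (\<lambda>k. - ?L k * ?g k)"
      unfolding proj laplacian_trig ..
    also have "- trig N (\<lambda>k. - ?L k * (- ?L k * ?c' k)) x + trig N (\<lambda>k. - ?L k * ?g k) x = trig N ?r x"
      by (simp only: trig_add[symmetric] trig_scale[symmetric])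
    finally show "trig N ?l x = trig N ?r x" .
  qed
  then have "fourier_coeff (trig N ?l) k = fourier_coeff (trig N ?r) k"
    by (rule arg_cong)
  moreover have "hermitian ?l" "hermitian ?r"
    using hermitian_fourier_coeff by (simp_all add: hermitian_def)
  ultimately have "?l k = ?r k"
    by (simp only: fourier_coeff_trig k)
  then show ?thesis by (simp add: power2_eq_square diff_divide_distrib algebra_simps)
qed

text \<open>
  The mode \<open>0\<close> does not move because its eigenvalue is \<open>0\<close>. This removes the one frequency that
  the gradient does not control.
\<close>

lemma mean_zero:
  assumes sol: "scheme_solution N \<tau> u0 u" "u0 \<in> L2_torus" and "0 < \<tau>" "torus_int u0 = 0"
  shows "fourier_coeff (u n) 0 = 0"
proof (induction n)
  case 0
  have z: "0 \<in> modes N" by (simp add: modes_iff)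
  have "u 0 = trig N (fourier_coeff u0)"
    using sol by (simp add: scheme_solution_def proj_X_eq L2_torus_integrable)
  then have "fourier_coeff (u 0) 0 = fourier_coeff u0 0"
    by (simp only: fourier_coeff_trig[OF hermitian_fourier_coeff z])
  then show ?case
    using assms(4) by (simp only: fourier_coeff_zero of_real_0)
next
  case (Suc n)
  then show ?case
    using scheme_fourier[OF sol, of 0 n] assms(3) lap_eig_zero_iff[of 0] by (simp add: modes_iff)
qed

section \<open>The maximum bound\<close>

text \<open>
  The rational constant \<open>6 < 2 \<pi>\<close> keeps the later arithmetic free of \<open>\<pi>\<close>.
\<close>

lemma sqrt_lap_eig_lower: "6 * \<bar>of_int (k $ j)\<bar> \<le> sqrt (lap_eig k)"
proof (rule real_le_rsqrt)
  have "(6 * \<bar>of_int (k $ j)\<bar>)\<^sup>2 \<le> (2 * pi * of_int (k $ j) :: real)\<^sup>2"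
  proof -
    have "6 * \<bar>of_int (k $ j)\<bar> \<le> 2 * pi * \<bar>of_int (k $ j) :: real\<bar>"
      using pi_gt3 by (intro mult_right_mono) auto
    then have "(6 * \<bar>of_int (k $ j)\<bar>)\<^sup>2 \<le> (2 * pi * \<bar>of_int (k $ j) :: real\<bar>)\<^sup>2"
      by (intro power_mono) auto
    then show ?thesis by (simp add: power_mult_distrib)
  qed
  also have "\<dots> \<le> lap_eig k"
    unfolding lap_eig_def by (rule member_le_sum) auto
  finally show "(6 * \<bar>of_int (k $ j)\<bar>)\<^sup>2 \<le> lap_eig k" .
qed

text \<open>
  The shell of maximum norm \<open>m\<close> has \<open>8 m\<close> points, each contributing at most \<open>1 / (6 m)\<^sup>3\<close>, so it
  contributes at most \<open>1 / (27 m\<^sup>2)\<close>. The bound \<open>1 / m\<^sup>2 \<le> 1 / (m - 1) - 1 / m\<close> for \<open>m \<ge> 2\<close>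
  makes the sum telescope; starting the induction at \<open>m = 1\<close> explains the \<open>Suc\<close>.
\<close>

lemma lattice_sum_Suc:
  "(\<Sum>k\<in>modes (Suc N) - {0}. 1 / sqrt (lap_eig k) ^ 3) \<le> (2 - 1 / (real N + 1)) / 27"
proof (induction N)
  have shell: "(\<Sum>k\<in>modes (Suc N) - {0}. 1 / sqrt (lap_eig k) ^ 3) \<le>
      (\<Sum>k\<in>modes N - {0}. 1 / sqrt (lap_eig k) ^ 3) + 1 / (27 * (real N + 1)\<^sup>2)" for N
  proof -
    let ?f = "\<lambda>k. 1 / sqrt (lap_eig k) ^ 3"
    have sub: "modes N \<subseteq> modes (Suc N)"
    proof
      fix k assume "k \<in> modes N"
      then have "\<bar>k $ j\<bar> \<le> int N" for j by (simp add: modes_iff)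
      from order_trans[OF this] show "k \<in> modes (Suc N)" by (simp add: modes_iff)
    qed
    have z: "0 \<in> modes N" by (simp add: modes_iff)
    have "(\<Sum>k\<in>modes (Suc N) - {0}. ?f k) =
        (\<Sum>k\<in>modes N - {0}. ?f k) + (\<Sum>k\<in>modes (Suc N) - modes N. ?f k)"
      using sub z by (subst sum.union_disjoint[symmetric]) (auto intro!: sum.cong)
    also have "(\<Sum>k\<in>modes (Suc N) - modes N. ?f k) \<le>
        real (card (modes (Suc N) - modes N)) * (1 / (6 * (real N + 1)) ^ 3)"
    proof (rule sum_bounded_above)
      fix k assume "k \<in> modes (Suc N) - modes N"
      then obtain j where j: "\<bar>k $ j\<bar> > int N" by (auto simp: modes_iff not_le)
      then have "real N + 1 \<le> \<bar>of_int (k $ j)\<bar>" by linarith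
      then have "6 * (real N + 1) \<le> 6 * \<bar>of_int (k $ j)\<bar>"
        by (rule mult_left_mono) simp
      also have "\<dots> \<le> sqrt (lap_eig k)"
        by (rule sqrt_lap_eig_lower)
      finally have "6 * (real N + 1) \<le> sqrt (lap_eig k)" .
      then show "?f k \<le> 1 / (6 * (real N + 1)) ^ 3"
        by (intro frac_le power_mono) auto
    qed
    also have "card (modes (Suc N) - modes N) = 8 * (N + 1)"
      using sub by (simp add: card_Diff_subset card_modes power2_eq_square algebra_simps)
    also have "real (8 * (N + 1)) * (1 / (6 * (real N + 1)) ^ 3) = 1 / (27 * (real N + 1)\<^sup>2)"
      by (simp add: divide_simps power2_eq_square power3_eq_cube) (simp add: algebra_simps)
    finally show ?thesis by simp
  qed
  {
    case 0
    have "modes 0 = {0}" by (auto simp: modes_iff vec_eq_iff)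
    then show ?case using shell[of 0] by simp
  next
    case (Suc N)
    have "1 / (27 * (real (Suc N) + 1)\<^sup>2) \<le> (1 / (real N + 1) - 1 / (real (Suc N) + 1)) / 27"
      by (simp add: divide_simps power2_eq_square)
    note order_trans[OF shell[of "Suc N"] add_mono[OF Suc this]]
    also have "(2 - 1 / (real N + 1)) / 27 + (1 / (real N + 1) - 1 / (real (Suc N) + 1)) / 27 =
        (2 - 1 / (real (Suc N) + 1)) / 27"
      by (simp only: add_divide_distrib[symmetric]) simp
    finally show ?case .
  }
qed

lemma lattice_sum: "(\<Sum>k\<in>modes N - {0}. 1 / sqrt (lap_eig k) ^ 3) \<le> 2 / 27"
proof (cases N)
  case 0
  then have "modes N = {0}" by (auto simp: modes_iff vec_eq_iff)
  then show ?thesis by simp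
next
  case (Suc m)
  have "(2 - 1 / (real m + 1)) / 27 \<le> 2 / (27 :: real)" by simp
  then show ?thesis unfolding Suc by (rule order_trans[OF lattice_sum_Suc])
qed

text \<open>
  With \<open>r = |2 \<pi> k|\<close> and \<open>q\<^sup>4 = \<tau>\<close>, these are the squares of the factors that one step puts on
  \<open>r |c|\<close> and on \<open>|g|\<close>. The power \<open>r\<^sup>3\<close> is chosen because its reciprocal is summable
  over the lattice while the resulting powers of \<open>q\<close> are exactly those that the bound
  \<open>3 E q \<le> 1\<close> absorbs. In terms of \<open>y = q r\<close> the two claims are \<open>y \<le> (1 + y\<^sup>4)\<^sup>2\<close> and
  \<open>y ^ 7 \<le> (1 + y\<^sup>4)\<^sup>2\<close>.
\<close>

lemma multiplier_bounds:
  fixes q r :: real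
  assumes "0 < q" "0 < r"
  shows "(1 / (r * (1 + (q * r) ^ 4)))\<^sup>2 \<le> 1 / q * (1 / r ^ 3)"
    and "(q ^ 4 * r\<^sup>2 / (1 + (q * r) ^ 4))\<^sup>2 \<le> q * (1 / r ^ 3)"
proof -
  define y where "y = q * r"
  have y: "y > 0" using assms by (simp add: y_def)
  define D where "D = 1 + y ^ 4"
  have D: "D \<ge> 1" using y by (simp add: D_def)
  have "y \<le> D"
  proof (cases "y \<le> 1")
    case False
    then have "y ^ 1 \<le> y ^ 4" by (intro power_increasing) auto
    then show ?thesis by (simp add: D_def)
  qed (use D in simp)
  also have "D \<le> D\<^sup>2" using D by (simp add: power2_eq_square)
  finally have 1: "y \<le> D\<^sup>2" .
  have 2: "y ^ 7 \<le> D\<^sup>2"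
  proof (cases "y \<le> 1")
    case True
    then have "y ^ 7 \<le> 1" using y by (intro power_le_one) auto
    also have "1 \<le> D\<^sup>2" using D by simp
    finally show ?thesis .
  next
    case False
    then have "y ^ 7 \<le> y ^ 8" by (intro power_increasing) auto
    also have "\<dots> = (y ^ 4)\<^sup>2" by simp
    also have "\<dots> \<le> D\<^sup>2" using y by (intro power_mono) (auto simp: D_def)
    finally show ?thesis .
  qed
  have "(1 / (r * D))\<^sup>2 = 1 / (r\<^sup>2 * D\<^sup>2)"
    by (simp add: power_mult_distrib power_divide)
  also have "\<dots> \<le> 1 / (r\<^sup>2 * y)"
    using 1 assms y D by (intro divide_left_mono mult_left_mono mult_pos_pos) auto
  also have "\<dots> = 1 / q * (1 / r ^ 3)"
    by (simp add: y_def power2_eq_square power3_eq_cube)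
  finally show "(1 / (r * (1 + (q * r) ^ 4)))\<^sup>2 \<le> 1 / q * (1 / r ^ 3)"
    by (simp add: D_def y_def)
  have "(q ^ 4 * r\<^sup>2 / D)\<^sup>2 = q / r ^ 3 * (y ^ 7 / D\<^sup>2)"
    using assms by (simp add: y_def power_mult_distrib power_divide divide_simps flip: power_mult power_add power_Suc power_Suc2)
  also have "\<dots> \<le> q / r ^ 3 * 1"
    using 2 assms D by (intro mult_left_mono) auto
  finally show "(q ^ 4 * r\<^sup>2 / (1 + (q * r) ^ 4))\<^sup>2 \<le> q * (1 / r ^ 3)"
    by (simp add: D_def y_def)
qed

text \<open>
  Solve the scheme for \<open>c' = (c - \<tau> L g) / (1 + \<tau> L\<^sup>2)\<close>, bound \<open>u (Suc n)\<close> by the sum of the \<open>|c'|\<close>,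
  and apply the Cauchy-Schwarz inequality to the products \<open>(r |c|) a\<close> and \<open>|g| b\<close>, where \<open>r\<^sup>2 = L\<close> and
  \<open>a\<close>, \<open>b\<close> are the factors of \<open>multiplier_bounds\<close>. The sum of \<open>(r |c|)\<^sup>2\<close> is at most twice the energy.
  The sum of \<open>|g|\<^sup>2\<close> is at most the integral of \<open>(u n)\<^sup>2 ((u n)\<^sup>2 - 1)\<^sup>2\<close>, hence at most \<open>4 A\<^sup>2\<close> times
  the energy. The factor \<open>1/3\<close> in the conclusion rounds up \<open>sqrt (8 / 81)\<close>.
\<close>

lemma Linf_step:
  assumes sol: "scheme_solution N \<tau> u0 u" "u0 \<in> L2_torus"
    and q: "0 < q" "q ^ 4 = \<tau>"
    and mean: "fourier_coeff (u n) 0 = 0"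
    and energy: "3 * energy (u n) * q \<le> 1"
    and A: "AE x in torus_measure. \<bar>u n x\<bar> \<le> A" "0 \<le> A"
  shows "\<bar>u (Suc n) x\<bar> \<le> 2 / (9 * q) + A / 3"
proof -
  let ?c = "fourier_coeff (u n)" and ?c' = "fourier_coeff (u (Suc n))"
    and ?g = "fourier_coeff (\<lambda>x. nonlin (u n x))"
  define r where "r k = sqrt (lap_eig k)" for k
  \<comment> \<open>the frequencies with \<open>r k > 0\<close>, where \<open>a\<close> is a genuine quotient\<close>
  define K where "K = modes N - {0}"
  define a where "a k = 1 / (r k * (1 + (q * r k) ^ 4))" for k
  define b where "b k = q ^ 4 * (r k)\<^sup>2 / (1 + (q * r k) ^ 4)" for k
  note X = scheme_in_X_space[OF sol]
  have K: "finite K" "K \<subseteq> modes N" by (auto simp: K_def)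
  have r2: "(r k)\<^sup>2 = lap_eig k" for k by (simp add: r_def)
  have r_pos: "r k > 0" if "k \<in> K" for k
    using that lap_eig_zero_iff[of k] lap_eig_nonneg[of k] by (simp add: K_def r_def less_le)
  have tau: "\<tau> > 0" using q by auto
  have c'0: "?c' 0 = 0"
    using scheme_fourier[OF sol, of 0 n] mean tau lap_eig_zero_iff[of 0] by (simp add: modes_iff)
  have coeff_bound: "cmod (?c' k) \<le> \<bar>r k * cmod (?c k)\<bar> * \<bar>a k\<bar> + \<bar>cmod (?g k)\<bar> * \<bar>b k\<bar>" if k: "k \<in> K" for k
  proof -
    define D where "D = 1 + (q * r k) ^ 4"
    have D: "D > 0" using q r_pos[OF k] by (simp add: D_def add_pos_pos)
    have tL: "q ^ 4 * (lap_eig k)\<^sup>2 = (q * r k) ^ 4"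
      by (simp add: r2[symmetric] power_mult_distrib flip: power_mult)
    have "?c' k - ?c k = of_real \<tau> * (- (of_real (lap_eig k))\<^sup>2 * ?c' k - of_real (lap_eig k) * ?g k)"
      using scheme_fourier[OF sol, of k n] k K tau by (auto simp: field_simps)
    then have "of_real D * ?c' k = ?c k - of_real (\<tau> * lap_eig k) * ?g k"
      unfolding D_def tL[symmetric] q(2) by (simp add: algebra_simps)
    then have "?c' k = of_real (1 / D) * ?c k - of_real (\<tau> * lap_eig k / D) * ?g k"
      using D by (simp add: field_simps)
    then have "cmod (?c' k) \<le> cmod (of_real (1 / D) * ?c k) + cmod (of_real (\<tau> * lap_eig k / D) * ?g k)"
      by (metis norm_triangle_ineq4)
    also have "\<dots> = 1 / D * cmod (?c k) + \<tau> * lap_eig k / D * cmod (?g k)"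
      using D tau by (simp only: norm_mult norm_of_real) simp
    also have "\<dots> = (r k * cmod (?c k)) * a k + cmod (?g k) * b k"
      using r_pos[OF k] by (simp add: a_def b_def D_def r2 q(2))
    also have "\<dots> \<le> \<bar>r k * cmod (?c k)\<bar> * \<bar>a k\<bar> + \<bar>cmod (?g k)\<bar> * \<bar>b k\<bar>"
      using r_pos[OF k] by (intro add_mono mult_mono) (auto simp: a_def b_def D_def[symmetric] D less_imp_le)
    finally show ?thesis .
  qed
  have rc: "(\<Sum>k\<in>K. (r k * cmod (?c k))\<^sup>2) \<le> 2 * energy (u n)"
  proof -
    have "(\<Sum>k\<in>K. (r k * cmod (?c k))\<^sup>2) \<le> (\<Sum>k\<in>modes N. lap_eig k * (cmod (?c k))\<^sup>2)"
      unfolding power_mult_distrib r2 using K by (intro sum_mono2) auto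
    also have "\<dots> \<le> 2 * energy (u n)"
      unfolding energy_X_space[OF X] torus_int_eq by (simp add: integral_nonneg_AE)
    finally show ?thesis .
  qed
  have gg: "(\<Sum>k\<in>K. (cmod (?g k))\<^sup>2) \<le> 4 * A\<^sup>2 * energy (u n)"
  proof -
    note int = continuous_imp_torus_integrable
    have "(\<Sum>k\<in>K. (cmod (?g k))\<^sup>2) \<le> (\<Sum>k\<in>modes N. (cmod (?g k))\<^sup>2)"
      using K by (intro sum_mono2) auto
    also have "\<dots> \<le> torus_int (\<lambda>x. (nonlin (u n x))\<^sup>2)"
      by (intro bessel continuous_nonlin[OF X])
    also have "\<dots> \<le> torus_int (\<lambda>x. A\<^sup>2 * ((u n x)\<^sup>2 - 1)\<^sup>2)"
      unfolding torus_int_eq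
    proof (rule integral_mono_AE)
      show "AE x in torus_measure. (nonlin (u n x))\<^sup>2 \<le> A\<^sup>2 * ((u n x)\<^sup>2 - 1)\<^sup>2"
        using A(1)
      proof eventually_elim
        case (elim x)
        have "(nonlin (u n x))\<^sup>2 = (u n x)\<^sup>2 * ((u n x)\<^sup>2 - 1)\<^sup>2"
          by (simp add: nonlin_def algebra_simps power2_eq_square power3_eq_cube)
        also have "\<dots> \<le> A\<^sup>2 * ((u n x)\<^sup>2 - 1)\<^sup>2"
          using elim A(2) by (intro mult_right_mono) (simp_all add: abs_le_square_iff[symmetric])
        finally show ?case .
      qed
    qed (intro int continuous_intros continuous_nonlin[OF X] continuous_X_space[OF X])+
    also have "\<dots> = A\<^sup>2 * torus_int (\<lambda>x. ((u n x)\<^sup>2 - 1)\<^sup>2)"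
      unfolding torus_int_eq by simp
    also have "\<dots> \<le> A\<^sup>2 * (4 * energy (u n))"
      unfolding energy_X_space[OF X] by (intro mult_left_mono) (simp_all add: sum_nonneg)
    finally show ?thesis by simp
  qed
  have aa: "(\<Sum>k\<in>K. (a k)\<^sup>2) \<le> 1 / q * (2 / 27)"
  proof -
    have "(\<Sum>k\<in>K. (a k)\<^sup>2) \<le> (\<Sum>k\<in>K. 1 / q * (1 / r k ^ 3))"
      unfolding a_def using q r_pos by (intro sum_mono multiplier_bounds)
    also have "\<dots> = 1 / q * (\<Sum>k\<in>K. 1 / r k ^ 3)"
      by (rule sum_distrib_left[symmetric])
    also have "\<dots> \<le> 1 / q * (2 / 27)"
      unfolding K_def r_def using q by (intro mult_left_mono lattice_sum) auto
    finally show ?thesis .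
  qed
  have bb: "(\<Sum>k\<in>K. (b k)\<^sup>2) \<le> q * (2 / 27)"
  proof -
    have "(\<Sum>k\<in>K. (b k)\<^sup>2) \<le> (\<Sum>k\<in>K. q * (1 / r k ^ 3))"
      unfolding b_def using q r_pos by (intro sum_mono multiplier_bounds)
    also have "\<dots> = q * (\<Sum>k\<in>K. 1 / r k ^ 3)"
      by (rule sum_distrib_left[symmetric])
    also have "\<dots> \<le> q * (2 / 27)"
      unfolding K_def r_def using q by (intro mult_left_mono lattice_sum) auto
    finally show ?thesis .
  qed
  have E: "energy (u n) \<le> 1 / (3 * q)"
    using energy q by (simp add: field_simps)
  have first: "L2_set (\<lambda>k. r k * cmod (?c k)) K * L2_set a K \<le> 2 / (9 * q)"
  proof -
    have "L2_set (\<lambda>k. r k * cmod (?c k)) K * L2_set a K \<le> sqrt (2 * (1 / (3 * q))) * sqrt (1 / q * (2 / 27))"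
      unfolding L2_set_def using rc aa E q
      by (intro mult_mono real_sqrt_le_mono) (auto simp: sum_nonneg intro: order_trans)
    also have "\<dots> = sqrt ((2 / (9 * q))\<^sup>2)"
      by (simp add: real_sqrt_mult[symmetric] power2_eq_square del: real_sqrt_abs)
    also have "\<dots> = 2 / (9 * q)" using q by simp
    finally show ?thesis .
  qed
  have second: "L2_set (\<lambda>k. cmod (?g k)) K * L2_set b K \<le> A / 3"
  proof -
    have "4 * A\<^sup>2 * energy (u n) \<le> 4 * A\<^sup>2 * (1 / (3 * q))"
      using E by (intro mult_left_mono) auto
    then have "L2_set (\<lambda>k. cmod (?g k)) K * L2_set b K \<le> sqrt (4 * A\<^sup>2 * (1 / (3 * q))) * sqrt (q * (2 / 27))"
      unfolding L2_set_def using gg bb q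
      by (intro mult_mono real_sqrt_le_mono) (auto simp: sum_nonneg intro: order_trans)
    also have "\<dots> = sqrt (8 / 81 * A\<^sup>2)"
      using q by (simp add: real_sqrt_mult[symmetric] del: real_sqrt_abs)
    also have "\<dots> \<le> sqrt ((A / 3)\<^sup>2)"
      by (intro real_sqrt_le_mono) (simp add: power_divide)
    also have "\<dots> = A / 3" using A(2) by simp
    finally show ?thesis .
  qed
  have "\<bar>u (Suc n) x\<bar> = \<bar>trig N ?c' x\<bar>"
    using X_space_eq_trig[OF X] by metis
  also have "\<dots> \<le> (\<Sum>k\<in>modes N. cmod (?c' k))"
    by (rule abs_trig_le)
  also have "\<dots> = (\<Sum>k\<in>K. cmod (?c' k))"
    using c'0 by (intro sum.mono_neutral_right) (auto simp: K_def)
  also have "\<dots> \<le> (\<Sum>k\<in>K. \<bar>r k * cmod (?c k)\<bar> * \<bar>a k\<bar> + \<bar>cmod (?g k)\<bar> * \<bar>b k\<bar>)"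
    by (intro sum_mono coeff_bound)
  also have "\<dots> \<le> L2_set (\<lambda>k. r k * cmod (?c k)) K * L2_set a K + L2_set (\<lambda>k. cmod (?g k)) K * L2_set b K"
    unfolding sum.distrib by (intro add_mono L2_set_mult_ineq)
  also have "\<dots> \<le> 2 / (9 * q) + A / 3"
    using first second by simp
  finally show ?thesis .
qed

section \<open>Dissipation of energy\<close>

text \<open>
  The increment of the potential is its tangent term plus \<open>(b - a)\<^sup>2\<close> times
  \<open>3/4 a\<^sup>2 + 1/2 a b + 1/4 b\<^sup>2 - 1/2\<close>; by \<open>2 a b \<le> a\<^sup>2 + b\<^sup>2\<close> this factor is at most its value
  at \<open>a = b = M\<close>.
\<close>

lemma potential_increment:
  fixes a b M :: real
  assumes "\<bar>a\<bar> \<le> M" "\<bar>b\<bar> \<le> M"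
  shows "1/4 * (b\<^sup>2 - 1)\<^sup>2 - 1/4 * (a\<^sup>2 - 1)\<^sup>2 \<le> nonlin a * (b - a) + (3 * M\<^sup>2 - 1) / 2 * (b - a)\<^sup>2"
proof -
  have M: "a\<^sup>2 \<le> M\<^sup>2" "b\<^sup>2 \<le> M\<^sup>2"
    using assms abs_le_square_iff[of a M] abs_le_square_iff[of b M] by auto
  have "0 \<le> (a - b)\<^sup>2" by simp
  then have ab: "3/4 * a\<^sup>2 + 1/2 * (a * b) + 1/4 * b\<^sup>2 \<le> 3/2 * M\<^sup>2"
    using M by (simp add: power2_diff mult.assoc)
  have "1/4 * (b\<^sup>2 - 1)\<^sup>2 - 1/4 * (a\<^sup>2 - 1)\<^sup>2 =
      nonlin a * (b - a) + (3/4 * a\<^sup>2 + 1/2 * (a * b) + 1/4 * b\<^sup>2 - 1/2) * (b - a)\<^sup>2"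
    unfolding nonlin_def by (simp add: field_simps power2_eq_square power3_eq_cube)
  also have "\<dots> \<le> nonlin a * (b - a) + (3 * M\<^sup>2 - 1) / 2 * (b - a)\<^sup>2"
    using ab by (intro add_left_mono mult_right_mono) (auto simp: field_simps)
  finally show ?thesis .
qed

text \<open>
  Eliminating \<open>g\<close> with the scheme turns the first three summands into
  \<open>- (1 / (\<tau> L) + L / 2) |c' - c|\<^sup>2\<close>, and the geometric mean of \<open>1 / (\<tau> L)\<close> and \<open>L / 2\<close> does not
  depend on the frequency.
\<close>

lemma mode_dissipation:
  fixes c c' g :: complex and L \<tau> :: real
  assumes "0 < \<tau>" "0 \<le> L"
    and eq: "(c' - c) / of_real \<tau> = - (of_real L)\<^sup>2 * c' - of_real L * g"
  shows "1/2 * (L * (cmod c')\<^sup>2) - 1/2 * (L * (cmod c)\<^sup>2) + Re ((c' - c) * cnj g)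
      + sqrt (2 / \<tau>) * (cmod (c' - c))\<^sup>2 \<le> 0"
proof (cases "L = 0")
  case True
  then have "c' = c" using assms by simp
  then show ?thesis by simp
next
  case False
  then have L: "L > 0" using assms by simp
  define d where "d = c' - c"
  have c: "c = c' - d" by (simp add: d_def)
  have "of_real L * g = - (d / of_real \<tau>) - (of_real L)\<^sup>2 * c'"
    using eq[folded d_def] by simp
  then have g: "g = of_real (- (1 / (\<tau> * L))) * d - of_real L * c'"
    using L assms(1) by (simp add: field_simps power2_eq_square)
  have "1/2 * (L * (cmod c')\<^sup>2) - 1/2 * (L * (cmod c)\<^sup>2) + Re (d * cnj g)
      = - ((1 / (\<tau> * L) + L / 2) * (cmod d)\<^sup>2)"
    unfolding c g cmod_power2 by (simp add: power2_eq_square algebra_simps add_divide_distrib)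
  moreover have "sqrt (2 / \<tau>) \<le> 1 / (\<tau> * L) + L / 2"
  proof -
    have "sqrt (2 / \<tau>) = 2 * sqrt (1 / (\<tau> * L) * (L / 2))"
      using L assms(1) by (simp add: real_sqrt_divide real_sqrt_mult divide_simps)
    also have "\<dots> \<le> 1 / (\<tau> * L) + L / 2"
      using arith_geo_mean_sqrt[of "1 / (\<tau> * L)" "L / 2"] L assms(1) by simp
    finally show ?thesis .
  qed
  then have "sqrt (2 / \<tau>) * (cmod d)\<^sup>2 \<le> (1 / (\<tau> * L) + L / 2) * (cmod d)\<^sup>2"
    by (rule mult_right_mono) simp
  ultimately show ?thesis
    unfolding d_def[symmetric] by linarith
qed

text \<open>
  Integrating \<open>potential_increment\<close> bounds the change of the potential energy by
  \<open>Re ((c' - c) * cnj g)\<close> plus the critical multiple of \<open>|c' - c|\<^sup>2\<close>, summed over the modes;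
  \<open>mode_dissipation\<close> then settles each mode separately.
\<close>

lemma energy_step:
  assumes sol: "scheme_solution N \<tau> u0 u" "u0 \<in> L2_torus" and tau: "0 < \<tau>"
    and M: "AE x in torus_measure. \<bar>u n x\<bar> \<le> M" "AE x in torus_measure. \<bar>u (Suc n) x\<bar> \<le> M"
    and K: "(3 * M\<^sup>2 - 1) / 2 \<le> sqrt (2 / \<tau>)"
  shows "energy (u (Suc n)) \<le> energy (u n)"
proof -
  let ?c = "fourier_coeff (u n)" and ?c' = "fourier_coeff (u (Suc n))"
    and ?g = "fourier_coeff (\<lambda>x. nonlin (u n x))"
  let ?d = "\<lambda>k. ?c' k - ?c k"
  define C where "C = (3 * M\<^sup>2 - 1) / 2"
  note X = scheme_in_X_space[OF sol]
  note int = continuous_imp_torus_integrable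
  note cont = continuous_intros continuous_nonlin[OF X] continuous_X_space[OF X]
  have dX: "(\<lambda>x. u (Suc n) x - u n x) = trig N ?d"
  proof
    fix x
    have rep: "trig N (fourier_coeff (u m)) = u m" for m
      using X by (rule X_space_eq_trig[symmetric])
    show "u (Suc n) x - u n x = trig N ?d x"
      by (simp only: trig_diff[symmetric] rep)
  qed
  have hd: "hermitian ?d"
    using hermitian_fourier_coeff by (simp add: hermitian_def)
  have dd: "torus_int (\<lambda>x. (u (Suc n) x - u n x)\<^sup>2) = (\<Sum>k\<in>modes N. (cmod (?d k))\<^sup>2)"
    unfolding dX[THEN fun_cong] torus_int_power2_X_space[OF trig_in_X_space]
    by (intro sum.cong refl) (simp only: fourier_coeff_trig[OF hd])
  have gd: "torus_int (\<lambda>x. nonlin (u n x) * (u (Suc n) x - u n x)) = (\<Sum>k\<in>modes N. Re (?d k * cnj (?g k)))"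
    unfolding dX[THEN fun_cong] by (intro torus_int_mult_trig int cont)
  have "torus_int (\<lambda>x. 1/4 * ((u (Suc n) x)\<^sup>2 - 1)\<^sup>2 - 1/4 * ((u n x)\<^sup>2 - 1)\<^sup>2)
      \<le> torus_int (\<lambda>x. nonlin (u n x) * (u (Suc n) x - u n x) + C * (u (Suc n) x - u n x)\<^sup>2)"
    unfolding torus_int_eq
  proof (rule integral_mono_AE)
    show "AE x in torus_measure. 1/4 * ((u (Suc n) x)\<^sup>2 - 1)\<^sup>2 - 1/4 * ((u n x)\<^sup>2 - 1)\<^sup>2
      \<le> nonlin (u n x) * (u (Suc n) x - u n x) + C * (u (Suc n) x - u n x)\<^sup>2"
      using M unfolding C_def by eventually_elim (rule potential_increment)
  qed (intro int cont)+
  also have "\<dots> = (\<Sum>k\<in>modes N. Re (?d k * cnj (?g k))) + C * (\<Sum>k\<in>modes N. (cmod (?d k))\<^sup>2)"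
    unfolding gd[symmetric] dd[symmetric] torus_int_eq
    by (subst Bochner_Integration.integral_add) (auto intro!: int cont)
  also have "\<dots> \<le> (\<Sum>k\<in>modes N. Re (?d k * cnj (?g k))) + sqrt (2 / \<tau>) * (\<Sum>k\<in>modes N. (cmod (?d k))\<^sup>2)"
    using K unfolding C_def by (intro add_left_mono mult_right_mono sum_nonneg) auto
  finally have pot: "torus_int (\<lambda>x. 1/4 * ((u (Suc n) x)\<^sup>2 - 1)\<^sup>2 - 1/4 * ((u n x)\<^sup>2 - 1)\<^sup>2) \<le> \<dots>" .
  have split: "torus_int (\<lambda>x. 1/4 * ((u (Suc n) x)\<^sup>2 - 1)\<^sup>2 - 1/4 * ((u n x)\<^sup>2 - 1)\<^sup>2) =
      1/4 * torus_int (\<lambda>x. ((u (Suc n) x)\<^sup>2 - 1)\<^sup>2) - 1/4 * torus_int (\<lambda>x. ((u n x)\<^sup>2 - 1)\<^sup>2)"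
    unfolding torus_int_eq
    by (subst Bochner_Integration.integral_diff) (auto intro!: int cont)
  have "1/2 * (\<Sum>k\<in>modes N. lap_eig k * (cmod (?c' k))\<^sup>2) - 1/2 * (\<Sum>k\<in>modes N. lap_eig k * (cmod (?c k))\<^sup>2)
      + (\<Sum>k\<in>modes N. Re (?d k * cnj (?g k))) + sqrt (2 / \<tau>) * (\<Sum>k\<in>modes N. (cmod (?d k))\<^sup>2) =
      (\<Sum>k\<in>modes N. 1/2 * (lap_eig k * (cmod (?c' k))\<^sup>2) - 1/2 * (lap_eig k * (cmod (?c k))\<^sup>2)
      + Re (?d k * cnj (?g k)) + sqrt (2 / \<tau>) * (cmod (?d k))\<^sup>2)"
    by (simp only: sum.distrib sum_subtractf sum_distrib_left)
  also have "\<dots> \<le> 0"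
  proof (rule sum_nonpos)
    fix k assume "k \<in> modes N"
    then show "1/2 * (lap_eig k * (cmod (?c' k))\<^sup>2) - 1/2 * (lap_eig k * (cmod (?c k))\<^sup>2)
      + Re (?d k * cnj (?g k)) + sqrt (2 / \<tau>) * (cmod (?d k))\<^sup>2 \<le> 0"
      by (intro mode_dissipation[OF tau lap_eig_nonneg] scheme_fourier[OF sol])
  qed
  finally show ?thesis
    using pot unfolding split energy_X_space[OF X] by linarith
qed

section \<open>The time step restriction\<close>

lemma F_const_lower: "0 \<le> E \<Longrightarrow> 3 * E \<le> sqrt (F_const E)"
  by (simp add: F_const_def)

text \<open>
  If \<open>F > 1\<close>, the logarithmic factor is at least \<open>1\<close>, so \<open>q\<^sup>2 F \<le> 1\<close>; otherwise \<open>q \<le> 1\<close> gives the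
  same. The square root of this inequality meets \<open>3 E \<le> sqrt F\<close>.
\<close>

lemma tau_max_bound:
  assumes "0 \<le> E" "0 < q" "q ^ 4 \<le> tau_max (F_const E)"
  shows "3 * E * q \<le> 1" "q ^ 4 \<le> 1/2"
proof -
  define F where "F = F_const E"
  show half: "q ^ 4 \<le> 1/2"
    using assms(3) by (auto simp: tau_max_def split: if_splits)
  have "q\<^sup>2 * F \<le> 1"
  proof (cases "F \<le> 1")
    case True
    have "q ^ 4 \<le> 1 ^ 4" using half by simp
    then have "q \<le> 1" by (rule power_le_imp_le_base[of q 3, simplified]) simp
    then have "q\<^sup>2 \<le> 1" using assms(2) by (simp add: power_le_one)
    moreover have "0 \<le> F" by (simp add: F_def F_const_def)
    ultimately show ?thesis using True mult_mono[of "q\<^sup>2" 1 F 1] by simp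
  next
    case False
    then have ln: "0 < ln F" "0 < F" by simp_all
    then have "F \<le> F * (1 + ln F)" by (simp add: algebra_simps)
    then have "F\<^sup>2 \<le> (F * (1 + ln F))\<^sup>2" using False by (intro power_mono) auto
    have "q ^ 4 \<le> 1 / (F * (1 + ln F))\<^sup>2"
      using assms(3) False by (simp add: tau_max_def F_def)
    also have "\<dots> \<le> 1 / F\<^sup>2"
      using \<open>F\<^sup>2 \<le> _\<close> ln by (intro frac_le) auto
    finally have "(q\<^sup>2 * F)\<^sup>2 \<le> 1\<^sup>2"
      using False by (simp add: power_mult_distrib field_simps)
    then show ?thesis by (rule power2_le_imp_le) simp
  qed
  then have "sqrt (q\<^sup>2 * F) \<le> 1" by simp
  then have "q * sqrt F \<le> 1" using assms(2) by (simp add: real_sqrt_mult)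
  moreover have "q * (3 * E) \<le> q * sqrt F"
    using F_const_lower assms unfolding F_def by (intro mult_left_mono) auto
  ultimately show "3 * E * q \<le> 1" by (simp add: mult_ac)
qed

text \<open>
  \<open>M\<close> solves \<open>(3 M\<^sup>2 - 1) / 2 = sqrt (2 / \<tau>)\<close> for \<open>\<tau> = q\<^sup>4\<close>, the largest modulus that \<open>energy_step\<close>
  tolerates. The restriction \<open>\<tau> \<le> 1/2\<close> gives \<open>M\<^sup>2 \<ge> 5/3\<close>, which exceeds \<open>1.25\<^sup>2\<close>, and
  \<open>M \<ge> 1 / (3 q)\<close> makes the bound of \<open>Linf_step\<close> reproduce itself.
\<close>

lemma critical_bound:
  fixes q M :: real
  assumes q: "0 < q" "q ^ 4 \<le> 1/2"
    and M: "M = sqrt ((1 + 2 * sqrt (2 / q ^ 4)) / 3)"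
  shows "1.25 \<le> M" "(3 * M\<^sup>2 - 1) / 2 = sqrt (2 / q ^ 4)" "2 / (9 * q) + M / 3 \<le> M"
proof -
  have M2: "M\<^sup>2 = (1 + 2 * sqrt (2 / q ^ 4)) / 3"
    using q by (simp add: M)
  then show "(3 * M\<^sup>2 - 1) / 2 = sqrt (2 / q ^ 4)" by simp
  have M0: "0 \<le> M" using q by (simp add: M)
  have "sqrt (2\<^sup>2) \<le> sqrt (2 / q ^ 4)"
    using q by (intro real_sqrt_le_mono) (simp add: field_simps)
  then have "1.25\<^sup>2 \<le> M\<^sup>2" unfolding M2 by (simp add: power2_eq_square)
  then show "1.25 \<le> M" using M0 by (rule power2_le_imp_le)
  have "(1 / q\<^sup>2) = sqrt ((1 / q\<^sup>2)\<^sup>2)" by simp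
  also have "\<dots> \<le> sqrt (2 / q ^ 4)"
    using q by (intro real_sqrt_le_mono) (simp add: power_divide divide_right_mono flip: power_mult)
  finally have s: "1 / q\<^sup>2 \<le> sqrt (2 / q ^ 4)" .
  have "(1 / (3 * q))\<^sup>2 = 1 / 9 * (1 / q\<^sup>2)"
    by (simp add: power_divide power_mult_distrib)
  also have "\<dots> \<le> 1 / 9 * sqrt (2 / q ^ 4)"
    using s by (rule mult_left_mono) simp
  also have "\<dots> \<le> M\<^sup>2"
    using q unfolding M2 by simp
  finally have "(1 / (3 * q))\<^sup>2 \<le> M\<^sup>2" .
  then have "1 / (3 * q) \<le> M" using M0 by (rule power2_le_imp_le)
  then show "2 / (9 * q) + M / 3 \<le> M" by simp
qed

theorem theorem3p2:
  fixes N :: nat and u0 :: "real^2 \<Rightarrow> real" and u :: "nat \<Rightarrow> real^2 \<Rightarrow> real" and \<tau> :: real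
  assumes "N \<ge> 2"
    and "u0 \<in> H1_torus"
    and "torus_int u0 = 0"
    and "Linf_norm (proj_X N u0) \<le> ereal 1.25"
    and "0 < \<tau>" and "\<tau> \<le> tau_max (F_const (energy (proj_X N u0)))"
    and "scheme_solution N \<tau> u0 u"
  shows "\<forall>n. energy (u (Suc n)) \<le> energy (u n)"
proof -
  have L2: "u0 \<in> L2_torus" using assms(2) by (simp add: H1_torus_def)
  note sol = assms(7) L2
  note X = scheme_in_X_space[OF sol]
  have u_0: "u 0 = proj_X N u0" using assms(7) by (simp add: scheme_solution_def)
  define q where "q = root 4 \<tau>"
  have q: "0 < q" "q ^ 4 = \<tau>" using assms(5) by (simp_all add: q_def)
  have E0: "0 \<le> energy (u 0)" by (rule energy_nonneg[OF X])
  have qE: "3 * energy (u 0) * q \<le> 1" "q ^ 4 \<le> 1/2"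
    using tau_max_bound[OF E0 q(1)] assms(6) q(2) u_0 by simp_all
  define M where "M = sqrt ((1 + 2 * sqrt (2 / q ^ 4)) / 3)"
  note crit = critical_bound[OF q(1) qE(2) M_def]
  have initial: "AE x in torus_measure. \<bar>u 0 x\<bar> \<le> M"
  proof -
    have "AE x in torus_measure. ereal \<bar>u 0 x\<bar> \<le> Linf_norm (u 0)"
      unfolding Linf_norm_def by (rule esssup_AE)
    then show ?thesis
    proof eventually_elim
      case (elim x)
      then have "ereal \<bar>u 0 x\<bar> \<le> ereal 1.25" using assms(4) u_0 order_trans by metis
      then show ?case using crit(1) by simp
    qed
  qed
  have step: "\<bar>u (Suc n) x\<bar> \<le> M"
    if "energy (u n) \<le> energy (u 0)" "AE x in torus_measure. \<bar>u n x\<bar> \<le> M" for n x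
  proof -
    have "3 * energy (u n) * q \<le> 3 * energy (u 0) * q"
      using that(1) q(1) by simp
    then have "\<bar>u (Suc n) x\<bar> \<le> 2 / (9 * q) + M / 3"
      using that(2) crit(1) qE(1) mean_zero[OF sol assms(5,3)]
      by (intro Linf_step[OF sol q]) auto
    then show ?thesis using crit(3) by simp
  qed
  have decrease: "energy (u (Suc n)) \<le> energy (u n)"
    if "energy (u n) \<le> energy (u 0)" "AE x in torus_measure. \<bar>u n x\<bar> \<le> M" for n
  proof (rule energy_step[OF sol assms(5) that(2)])
    show "AE x in torus_measure. \<bar>u (Suc n) x\<bar> \<le> M"
      by (intro AE_I2 step that)
    show "(3 * M\<^sup>2 - 1) / 2 \<le> sqrt (2 / \<tau>)"
      using crit(2) q(2) by simp
  qed
  have "energy (u n) \<le> energy (u 0) \<and> (AE x in torus_measure. \<bar>u n x\<bar> \<le> M)" for n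
  proof (induction n)
    case (Suc n)
    then have "energy (u (Suc n)) \<le> energy (u 0)"
      using decrease[of n] by linarith
    moreover have "AE x in torus_measure. \<bar>u (Suc n) x\<bar> \<le> M"
      by (rule AE_I2, rule step) (use Suc in blast)+
    ultimately show ?case by blast
  qed (use initial in simp)
  then show ?thesis using decrease by blast
qed

end
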